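(* Let $S_n=(S_n^x,S_n^y)$, $n\ge 0$, be the simple random walk on the 2-dimensional comb $\mathbf C_2$ started at $S_0=(0,0)$, and let $M_n^x=\max\{S_i^x-S_j^x:0\le i,j\le n\}$. Then $$\mathbb E[M_n^x]\sim\frac{2^{1/4}}{\Gamma(5/4)}\,n^{1/4}\qquad (n\to\infty).$$
   Context: The 2-dimensional comb $\mathbf C_2$ is the graph with vertex set $\mathbb Z^2$ obtained from the usual square lattice by removing all horizontal edges off the $x$-axis: $(x,y)$ is adjacent to $(x,y\pm1)$ for all $x,y\in\mathbb Z$, and $(x,0)$ is adjacent to $(x\pm1,0)$ for all $x\in\mathbb Z$. The simple random walk moves at each step to a uniformly chosen neighbour of the current vertex (transition probabilities $1/4$ from vertices on the $x$-axis and $1/2$ from other vertices). $a_n\sim b_n$ means $a_n/b_n\to1$, and $\Gamma$ is the Euler gamma function. *)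

theory Defs
  imports "HOL-Probability.Probability" "HOL-Library.Landau_Symbols"
begin

definition comb_adj :: "int \<times> int \<Rightarrow> int \<times> int \<Rightarrow> bool" where
  "comb_adj u v \<longleftrightarrow>
     fst u = fst v \<and> \<bar>snd u - snd v\<bar> = 1 \<or>
     snd u = 0 \<and> snd v = 0 \<and> \<bar>fst u - fst v\<bar> = 1"

text \<open>
  Simple random walk on a graph with edge relation \<open>E\<close>, started at \<open>v\<^sub>0\<close>, on an arbitrary
  probability space. Only meaningful if every neighbourhood is finite and nonempty, as
  \<^const>\<open>pmf_of_set\<close> is unspecified otherwise; the lemmas below show this for the comb.
\<close>

locale simple_random_walk = prob_space M for M :: "'w measure" +
  fixes E :: "'v \<Rightarrow> 'v \<Rightarrow> bool" and v\<^sub>0 :: 'v and S :: "nat \<Rightarrow> 'w \<Rightarrow> 'v"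
  assumes measurable_walk: "\<And>n. random_variable (count_space UNIV) (S n)"
    and start: "AE \<omega> in M. S 0 \<omega> = v\<^sub>0"
    and step: "\<And>n (p :: nat \<Rightarrow> 'v) w.
      \<P>(\<omega> in M. \<forall>i\<le>n. S i \<omega> = p i) > 0 \<Longrightarrow>
      \<P>(\<omega> in M. S (Suc n) \<omega> = w \<bar> \<forall>i\<le>n. S i \<omega> = p i) = pmf (pmf_of_set {u. E (p n) u}) w"

definition x_range :: "(nat \<Rightarrow> 'w \<Rightarrow> int \<times> int) \<Rightarrow> nat \<Rightarrow> 'w \<Rightarrow> int" where
  "x_range S n \<omega> = Max {fst (S i \<omega>) - fst (S j \<omega>) | i j. i \<le> n \<and> j \<le> n}"

lemma comb_neighbours_axis:
  "{v. comb_adj (x, 0) v} = {(x, 1), (x, - 1), (x + 1, 0), (x - 1, 0)}"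
  by (auto simp: comb_adj_def abs_if split: if_splits)

lemma comb_neighbours_off_axis:
  "y \<noteq> 0 \<Longrightarrow> {v. comb_adj (x, y) v} = {(x, y + 1), (x, y - 1)}"
  by (auto simp: comb_adj_def abs_if split: if_splits)

lemma comb_step_axis:
  "pmf (pmf_of_set {v. comb_adj (x, 0) v}) w = (if comb_adj (x, 0) w then 1 / 4 else 0)"
proof -
  have "w \<in> {v. comb_adj (x, 0) v} \<longleftrightarrow> comb_adj (x, 0) w" by simp
  then show ?thesis unfolding comb_neighbours_axis by (auto simp: indicator_def)
qed

lemma comb_step_off_axis:
  assumes "y \<noteq> 0"
  shows "pmf (pmf_of_set {v. comb_adj (x, y) v}) w = (if comb_adj (x, y) w then 1 / 2 else 0)"
proof -
  have "w \<in> {v. comb_adj (x, y) v} \<longleftrightarrow> comb_adj (x, y) w" by simp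
  then show ?thesis unfolding comb_neighbours_off_axis[OF assms] by (auto simp: indicator_def)
qed

end

theory Submission
  imports Defs "HOL-Real_Asymp.Real_Asymp"
begin

text \<open>
  The idea is to compute the expected range exactly as a coefficient of an algebraic power series
  and then to read off its asymptotics.

  The range of the first coordinate is its maximum plus the maximum of the walk reflected in
  the \<open>y\<close>-axis, and the reflected walk is again a simple random walk on the comb; so the expected
  range is \<open>2 * (\<Sum>k=1..n. h n k)\<close>, where \<open>h n k\<close> is the probability that column \<open>k\<close> has been reached
  by time \<open>n\<close> (\<open>expectation_x_range\<close>). By the Markov property, these hitting probabilities obey a
  linear recursion in \<open>n\<close> over the starting vertex (\<open>prob_hit\<close>). To reach column \<open>k\<close> from
  \<open>(0, 0)\<close> the walk has to advance by one column \<open>k\<close> times, so that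
  \<open>(\<Sum>n. h n k * X ^ n) = \<phi> ^ k / (1 - X)\<close>, where \<open>\<phi>\<close> is the generating function of the time to advance
  by one column. Instead of proving such a decomposition for the process, it suffices to check that
  these formal power series satisfy the recursion (\<open>hit_prob_halfplane\<close>).

  First-step analysis gives \<open>2 * \<psi> = X * (1 + \<psi>\<^sup>2)\<close> for the descent by one vertex on a tooth, and
  \<open>4 * \<phi> = X * (1 + \<phi>\<^sup>2 + 2 * \<psi> * \<phi>)\<close>. These equations are solved by halving the argument of the
  hyperbolic tangent: if \<open>X = tanh (4 * t)\<close>, then \<open>\<psi> = tanh (2 * t)\<close> and \<open>\<phi> = tanh t\<close>. With
  \<open>Q = exp (2 * t) = ((1 + X) / (1 - X)) powr (1/4)\<close> this means \<open>\<phi> = (Q - 1) / (Q + 1)\<close>, hence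
  \<open>2 * (\<Sum>k\<ge>1. \<phi> ^ k) = 2 * \<phi> / (1 - \<phi>) = Q - 1\<close>, and the expected range plus one is the coefficient of
  \<open>X ^ n\<close> in
  \<open>Q / (1 - X) = (1 + X) powr (1/4) * (1 - X) powr (-5/4)\<close> (\<open>sum_hit_fps\<close>).

  The coefficients of \<open>(1 - X) powr (-5/4)\<close> are asymptotic to \<open>n powr (1/4) / Gamma (5/4)\<close>, and those of
  \<open>(1 + X) powr (1/4)\<close> are absolutely summable with sum \<open>2 powr (1/4)\<close>. Convolution multiplies the two
  (\<open>binomial_convolution_tendsto\<close>).
\<close>

unbundle no vec_syntax
unbundle fps_syntax

section \<open>Hitting probabilities of random walks on graphs\<close>

text \<open>
  The probability of visiting \<open>A\<close> within \<open>n\<close> steps from \<open>v\<close>, by first-step analysis and hence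
  without reference to a process; \<open>prob_hit\<close> below identifies it for every realisation of the walk.
\<close>

primrec hit_prob :: "('v \<Rightarrow> 'v \<Rightarrow> bool) \<Rightarrow> 'v set \<Rightarrow> nat \<Rightarrow> 'v \<Rightarrow> real" where
  "hit_prob E A 0 v = of_bool (v \<in> A)"
| "hit_prob E A (Suc n) v =
     (if v \<in> A then 1 else (\<Sum>u | E v u. hit_prob E A n u) / card {u. E v u})"

context simple_random_walk
begin

lemma walk_in_measurable: "Measurable.pred M (\<lambda>\<omega>. S n \<omega> \<in> B)"
  using measurable_compose[OF measurable_walk, of "\<lambda>v. v \<in> B" "count_space UNIV" n] by simp

lemma walk_eq_measurable: "Measurable.pred M (\<lambda>\<omega>. S n \<omega> = v)"
  using walk_in_measurable[of n "{v}"] by simp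

lemma step_prob:
  assumes fin: "finite {u. E (p n) u}" and w: "E (p n) w"
  shows "\<P>(\<omega> in M. (\<forall>i\<le>n. S i \<omega> = p i) \<and> S (Suc n) \<omega> = w)
           = \<P>(\<omega> in M. \<forall>i\<le>n. S i \<omega> = p i) / card {u. E (p n) u}"
proof (cases "\<P>(\<omega> in M. \<forall>i\<le>n. S i \<omega> = p i) > 0")
  case True
  have "pmf (pmf_of_set {u. E (p n) u}) w = 1 / card {u. E (p n) u}"
    using fin w by (subst pmf_of_set) auto
  with step[OF True, of w] True show ?thesis
    by (simp add: cond_prob_def field_simps conj_commute)
next
  case False
  note [measurable] = walk_in_measurable walk_eq_measurable
  have "\<P>(\<omega> in M. (\<forall>i\<le>n. S i \<omega> = p i) \<and> S (Suc n) \<omega> = w)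
          \<le> \<P>(\<omega> in M. \<forall>i\<le>n. S i \<omega> = p i)"
    by (rule finite_measure_mono) auto
  with False show ?thesis by (smt (verit) divide_eq_0_iff measure_nonneg)
qed

text \<open>
  The Markov property for hitting events. Conditioning on the whole past, and not only on the
  present position, makes the induction go through: splitting over the next vertex \<open>w\<close> turns a
  past of length \<open>m\<close> into the past of length \<open>m + 1\<close> that is extended by \<open>w\<close>.
\<close>

lemma prob_hit_after_prefix:
  assumes fin: "\<And>v. finite {u. E v u}" and ne: "\<And>v. {u. E v u} \<noteq> {}"
  shows "\<P>(\<omega> in M. (\<forall>i\<le>m. S i \<omega> = p i) \<and> (\<exists>i\<in>{m..m + n}. S i \<omega> \<in> A))
           = \<P>(\<omega> in M. \<forall>i\<le>m. S i \<omega> = p i) * hit_prob E A n (p m)"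
proof (induction n arbitrary: m p)
  case 0
  have "{\<omega> \<in> space M. (\<forall>i\<le>m. S i \<omega> = p i) \<and> (\<exists>i\<in>{m..m + 0}. S i \<omega> \<in> A)} =
    (if p m \<in> A then {\<omega> \<in> space M. \<forall>i\<le>m. S i \<omega> = p i} else {})"
    by auto
  then show ?case by simp
next
  case (Suc n)
  note [measurable] = walk_in_measurable walk_eq_measurable
  define N where "N = {u. E (p m) u}"
  have finN: "finite N" using fin by (simp add: N_def)
  let ?C = "\<lambda>\<omega>. \<forall>i\<le>m. S i \<omega> = p i"
  show ?case
  proof (cases "p m \<in> A")
    case True
    have "{\<omega> \<in> space M. ?C \<omega> \<and> (\<exists>i\<in>{m..m + Suc n}. S i \<omega> \<in> A)} = {\<omega> \<in> space M. ?C \<omega>}"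
      using True by (auto intro!: bexI[of _ m])
    then show ?thesis using True by simp
  next
    case False
    let ?H = "\<lambda>\<omega>. \<exists>i\<in>{Suc m..Suc m + n}. S i \<omega> \<in> A"
    have card: "card N > 0" using fin ne[of "p m"] by (simp add: N_def card_gt_0_iff)
    \<comment> \<open>\<open>split\<close> is used twice: with \<open>P\<close> trivial it shows that the walk almost surely moves to a
      neighbour, and with \<open>P\<close> the later hitting event it gives the recursion.\<close>
    have split: "\<P>(\<omega> in M. ?C \<omega> \<and> S (Suc m) \<omega> \<in> N \<and> P \<omega>)
        = (\<Sum>w\<in>N. \<P>(\<omega> in M. ?C \<omega> \<and> S (Suc m) \<omega> = w \<and> P \<omega>))"
      if [measurable]: "Measurable.pred M P" for P
    proof -
      have "{\<omega> \<in> space M. ?C \<omega> \<and> S (Suc m) \<omega> \<in> N \<and> P \<omega>}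
        = (\<Union>w\<in>N. {\<omega> \<in> space M. ?C \<omega> \<and> S (Suc m) \<omega> = w \<and> P \<omega>})" by auto
      then show ?thesis
        by (simp only:, intro finite_measure_finite_Union finN)
           (auto simp: disjoint_family_on_def)
    qed
    have "\<P>(\<omega> in M. ?C \<omega> \<and> S (Suc m) \<omega> \<in> N) = (\<Sum>w\<in>N. \<P>(\<omega> in M. ?C \<omega> \<and> S (Suc m) \<omega> = w))"
      using split[of "\<lambda>_. True"] by simp
    also have "\<dots> = (\<Sum>w\<in>N. \<P>(\<omega> in M. ?C \<omega>) / card N)"
      by (simp add: N_def step_prob fin)
    also have "\<dots> = \<P>(\<omega> in M. ?C \<omega>)"
      using card by (simp only: sum_constant) simp
    finally have eq: "\<P>(\<omega> in M. ?C \<omega> \<and> S (Suc m) \<omega> \<in> N) = \<P>(\<omega> in M. ?C \<omega>)" .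
    have meas: "{\<omega> \<in> space M. ?C \<omega>} \<in> events" "{\<omega> \<in> space M. ?C \<omega> \<and> S (Suc m) \<omega> \<in> N} \<in> events"
      by measurable
    have "prob ({\<omega> \<in> space M. ?C \<omega>} - {\<omega> \<in> space M. ?C \<omega> \<and> S (Suc m) \<omega> \<in> N}) = 0"
      by (subst finite_measure_Diff[OF meas]) (use eq in \<open>blast, simp\<close>)
    also have "{\<omega> \<in> space M. ?C \<omega>} - {\<omega> \<in> space M. ?C \<omega> \<and> S (Suc m) \<omega> \<in> N}
       = {\<omega> \<in> space M. \<not> (?C \<omega> \<longrightarrow> S (Suc m) \<omega> \<in> N)}" by blast
    finally have null: "prob {\<omega> \<in> space M. \<not> (?C \<omega> \<longrightarrow> S (Suc m) \<omega> \<in> N)} = 0" .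
    have "{\<omega> \<in> space M. \<not> (?C \<omega> \<longrightarrow> S (Suc m) \<omega> \<in> N)} \<in> events"
      by measurable
    from null[unfolded prob_eq_0[OF this]] AE_space
    have AE: "AE \<omega> in M. ?C \<omega> \<longrightarrow> S (Suc m) \<omega> \<in> N"
      by eventually_elim blast
    have "\<P>(\<omega> in M. ?C \<omega> \<and> (\<exists>i\<in>{m..m + Suc n}. S i \<omega> \<in> A))
        = \<P>(\<omega> in M. ?C \<omega> \<and> S (Suc m) \<omega> \<in> N \<and> ?H \<omega>)"
    proof (rule finite_measure_eq_AE)
      have hit: "(\<exists>i\<in>{m..m + Suc n}. S i \<omega> \<in> A) \<longleftrightarrow> ?H \<omega>" if "?C \<omega>" for \<omega>
      proof -
        have "{m..m + Suc n} = insert m {Suc m..Suc m + n}" by auto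
        then show ?thesis using that False by auto
      qed
      show "AE \<omega> in M. \<omega> \<in> {\<omega> \<in> space M. ?C \<omega> \<and> (\<exists>i\<in>{m..m + Suc n}. S i \<omega> \<in> A)}
        \<longleftrightarrow> \<omega> \<in> {\<omega> \<in> space M. ?C \<omega> \<and> S (Suc m) \<omega> \<in> N \<and> ?H \<omega>}"
        using AE by eventually_elim (use hit in blast)
    qed measurable
    also have "\<dots> = (\<Sum>w\<in>N. \<P>(\<omega> in M. ?C \<omega> \<and> S (Suc m) \<omega> = w \<and> ?H \<omega>))"
      by (rule split) measurable
    also have "\<dots> = (\<Sum>w\<in>N. \<P>(\<omega> in M. ?C \<omega>) / card N * hit_prob E A n w)"
    proof (rule sum.cong[OF refl])
      fix w assume w: "w \<in> N"
      have pre: "(\<forall>i\<le>Suc m. S i \<omega> = (p(Suc m := w)) i) \<longleftrightarrow> ?C \<omega> \<and> S (Suc m) \<omega> = w" for \<omega>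
        by (auto simp: le_Suc_eq)
      show "\<P>(\<omega> in M. ?C \<omega> \<and> S (Suc m) \<omega> = w \<and> ?H \<omega>)
          = \<P>(\<omega> in M. ?C \<omega>) / card N * hit_prob E A n w"
        using Suc.IH[of "Suc m" "p(Suc m := w)"] w
        unfolding pre by (simp add: step_prob fin conj_assoc N_def)
    qed
    also have "\<dots> = \<P>(\<omega> in M. ?C \<omega>) * hit_prob E A (Suc n) (p m)"
      using False by (simp add: sum_distrib_left sum_divide_distrib N_def)
    finally show ?thesis .
  qed
qed

lemma prob_hit:
  assumes "\<And>v. finite {u. E v u}" and "\<And>v. {u. E v u} \<noteq> {}"
  shows "\<P>(\<omega> in M. \<exists>i\<le>n. S i \<omega> \<in> A) = hit_prob E A n v\<^sub>0"
proof -
  note [measurable] = walk_in_measurable walk_eq_measurable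
  have "\<P>(\<omega> in M. \<exists>i\<le>n. S i \<omega> \<in> A)
      = \<P>(\<omega> in M. (\<forall>i\<le>0. S i \<omega> = v\<^sub>0) \<and> (\<exists>i\<in>{0..0 + n}. S i \<omega> \<in> A))"
  proof (rule finite_measure_eq_AE)
    show "AE \<omega> in M. \<omega> \<in> {\<omega> \<in> space M. \<exists>i\<le>n. S i \<omega> \<in> A} \<longleftrightarrow>
        \<omega> \<in> {\<omega> \<in> space M. (\<forall>i\<le>0. S i \<omega> = v\<^sub>0) \<and> (\<exists>i\<in>{0..0 + n}. S i \<omega> \<in> A)}"
      using start by eventually_elim auto
  qed measurable
  also have "\<dots> = \<P>(\<omega> in M. \<forall>i\<le>0. S i \<omega> = v\<^sub>0) * hit_prob E A n v\<^sub>0"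
    using prob_hit_after_prefix[of 0 "\<lambda>_. v\<^sub>0" n A, OF assms] .
  also have "\<P>(\<omega> in M. \<forall>i\<le>0. S i \<omega> = v\<^sub>0) = 1"
    using start by (subst prob_Collect_eq_1) auto
  finally show ?thesis by simp
qed

end

text \<open>
  The step condition of the image walk along a path \<open>p\<close> is the step condition of the original
  walk along the preimage path, since \<open>f\<close> carries neighbourhoods onto neighbourhoods.
\<close>

lemma simple_random_walk_automorphism:
  assumes "simple_random_walk M E v S"
    and bij: "bij f" and E: "\<And>u w. E (f u) (f w) \<longleftrightarrow> E u w"
    and fin: "\<And>v. finite {u. E v u}" and ne: "\<And>v. {u. E v u} \<noteq> {}"
  shows "simple_random_walk M E (f v) (\<lambda>n \<omega>. f (S n \<omega>))"
proof -
  interpret simple_random_walk M E v S by fact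
  have inv: "f x = y \<longleftrightarrow> x = inv f y" for x y
    using bij by (metis bij_inv_eq_iff)
  show ?thesis
  proof
    show "random_variable (count_space UNIV) (\<lambda>\<omega>. f (S n \<omega>))" for n
      using measurable_compose[OF measurable_walk, of f "count_space UNIV" n] by simp
    show "AE \<omega> in M. f (S 0 \<omega>) = f v"
      using start by auto
    fix n p w assume "\<P>(\<omega> in M. \<forall>i\<le>n. f (S i \<omega>) = p i) > 0"
    then have "\<P>(\<omega> in M. S (Suc n) \<omega> = inv f w \<bar> \<forall>i\<le>n. S i \<omega> = inv f (p i))
        = pmf (pmf_of_set {u. E (inv f (p n)) u}) (inv f w)"
      unfolding inv by (rule step)
    moreover have "E (p n) u \<longleftrightarrow> E (inv f (p n)) (inv f u)" for u
      using E[of "inv f (p n)" "inv f u"] bij by (simp add: bij_is_surj surj_f_inv_f)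
    then have "{u. E (p n) u} = f ` {u. E (inv f (p n)) u}"
      using bij by (simp add: bij_image_Collect_eq)
    then have "pmf_of_set {u. E (p n) u} = map_pmf f (pmf_of_set {u. E (inv f (p n)) u})"
      using bij fin ne by (subst map_pmf_of_set_inj) (auto simp: bij_def intro: inj_on_subset)
    then have "pmf (pmf_of_set {u. E (p n) u}) w = pmf (pmf_of_set {u. E (inv f (p n)) u}) (inv f w)"
      by (metis bij bij_def inv pmf_map_inj')
    ultimately show "\<P>(\<omega> in M. f (S (Suc n) \<omega>) = w \<bar> \<forall>i\<le>n. f (S i \<omega>) = p i)
        = pmf (pmf_of_set {u. E (p n) u}) w"
      by (simp add: inv)
  qed
qed

section \<open>Generating functions of passage times on the comb\<close>

text \<open>
  If \<open>q = exp (2 * t)\<close> then \<open>(q - 1) / (q + 1) = tanh t\<close>, so squaring \<open>q\<close> doubles the argument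
  of a hyperbolic tangent.
\<close>

definition cayley :: "real fps \<Rightarrow> real fps" where
  "cayley q = (q - 1) * inverse (q + 1)"

lemma cayley_iff:
  assumes "q $ 0 = 1" shows "cayley q * (q + 1) = q - 1"
  using assms by (simp add: cayley_def mult.assoc inverse_mult_eq_1)

lemma cayley_nth_0: "q $ 0 = 1 \<Longrightarrow> cayley q $ 0 = 0"
  by (simp add: cayley_def)

text \<open>
  The double-angle formula \<open>tanh (2 * t) = 2 * tanh t / (1 + (tanh t)\<^sup>2)\<close>.
\<close>

lemma cayley_double:
  assumes "q $ 0 = 1"
  shows "2 * cayley q = cayley (q\<^sup>2) * (1 + (cayley q)\<^sup>2)"
proof -
  have q2: "q\<^sup>2 $ 0 = 1" using assms by (simp add: power2_eq_square)
  note c = cayley_iff[OF assms] cayley_iff[OF q2]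
  have "q + 1 \<noteq> 0" "q\<^sup>2 + 1 \<noteq> 0"
    using assms q2 by (auto simp: fps_eq_iff intro!: exI[of _ 0])
  moreover have "(q + 1)\<^sup>2 * (q\<^sup>2 + 1) * (2 * cayley q) = (q + 1)\<^sup>2 * (q\<^sup>2 + 1) * (cayley (q\<^sup>2) * (1 + (cayley q)\<^sup>2))"
    using c by algebra
  ultimately show ?thesis by simp
qed

text \<open>
  The series \<open>((1 + X) / (1 - X)) powr (1/4)\<close>, so that \<^const>\<open>cayley\<close> of its fourth power is \<open>X\<close>.
\<close>

definition quartic_root :: "real fps" where
  "quartic_root = fps_binomial (1/4) * (fps_binomial (- (1/4)) oo - fps_X)"

lemma quartic_root_nth_0: "quartic_root $ 0 = 1"
  by (simp add: quartic_root_def fps_compose_uminus')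

lemma binomial_uminus_add:
  "fps_binomial (a + b) oo - fps_X = (fps_binomial a oo - fps_X) * (fps_binomial b oo - fps_X :: real fps)"
  by (simp add: fps_binomial_add_mult fps_compose_mult_distrib)

lemma binomial_uminus_1: "fps_binomial 1 oo - fps_X = (1 - fps_X :: real fps)"
  by (simp add: fps_binomial_1 fps_compose_add_distrib)

lemma quartic_root_power4: "quartic_root ^ 4 * (1 - fps_X) = 1 + fps_X"
proof -
  let ?f = "fps_binomial (- (1/4)) oo - fps_X :: real fps"
  have "?f ^ 4 * (1 - fps_X) = fps_binomial (-(1/4) + (-(1/4) + (-(1/4) + (-(1/4) + 1)))) oo - fps_X"
    unfolding binomial_uminus_add binomial_uminus_1 by (simp add: power4_eq_xxxx mult_ac)
  then have "?f ^ 4 * (1 - fps_X) = 1" by simp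
  moreover have "fps_binomial (1/4) ^ 4 = (1 + fps_X :: real fps)"
    by (simp add: fps_binomial_power fps_binomial_1)
  ultimately show ?thesis
    by (simp add: quartic_root_def power_mult_distrib mult_ac)
qed

text \<open>
  Writing \<open>X = tanh (4 * t)\<close>, these are \<open>tanh t\<close> and \<open>tanh (2 * t)\<close>. In probabilistic terms
  \<open>tooth_gf\<close> is the generating function of the time the walk needs to descend one vertex on a
  tooth, and \<open>axis_gf\<close> that of the time it needs to go from \<open>(x, 0)\<close> to \<open>(x + 1, 0)\<close>.
\<close>

definition axis_gf :: "real fps" where "axis_gf = cayley quartic_root"
definition tooth_gf :: "real fps" where "tooth_gf = cayley (quartic_root\<^sup>2)"

lemma cayley_quartic_root4: "cayley (quartic_root ^ 4) = fps_X"
proof -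
  let ?q = "quartic_root ^ 4"
  have 0: "?q $ 0 = 1" using quartic_root_nth_0 by (simp add: power4_eq_xxxx)
  then have "?q + 1 \<noteq> 0" by (auto simp: fps_eq_iff intro!: exI[of _ 0])
  moreover have "cayley ?q * (?q + 1) = fps_X * (?q + 1)"
    using cayley_iff[OF 0] quartic_root_power4 by algebra
  ultimately show ?thesis by simp
qed

text \<open>
  First-step analysis on a tooth: after one step the walk is one vertex closer to the axis or
  one vertex further away, each with probability one half.
\<close>

lemma tooth_gf_step: "2 * tooth_gf = fps_X * (1 + tooth_gf\<^sup>2)"
  using cayley_double[of "quartic_root\<^sup>2"] cayley_quartic_root4 quartic_root_nth_0
  by (simp add: tooth_gf_def power2_eq_square power4_eq_xxxx mult.assoc)

text \<open>
  First-step analysis on the axis: the walk steps to the right, to the left (then it has to gain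
  two columns) or, with probability one half, onto a tooth (then it has to come back first).
  Algebraically this combines two double-angle formulas, for \<open>tanh (2 * t)\<close> and for
  \<open>tanh (4 * t) = X\<close>.
\<close>

lemma axis_gf_step: "4 * axis_gf = fps_X * (1 + axis_gf\<^sup>2 + 2 * tooth_gf * axis_gf)"
proof -
  have "2 * axis_gf = tooth_gf * (1 + axis_gf\<^sup>2)"
    unfolding axis_gf_def tooth_gf_def by (rule cayley_double) (rule quartic_root_nth_0)
  then have "tooth_gf * (4 * axis_gf) = tooth_gf * (fps_X * (1 + axis_gf\<^sup>2 + 2 * tooth_gf * axis_gf))"
    using tooth_gf_step by algebra
  moreover have "tooth_gf \<noteq> 0" using tooth_gf_step by auto
  ultimately show ?thesis by simp
qed

lemma axis_gf_nth_0: "axis_gf $ 0 = 0"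
  unfolding axis_gf_def by (rule cayley_nth_0) (rule quartic_root_nth_0)

text \<open>
  The geometric sum; in the limit \<open>n \<rightarrow> \<infinity>\<close> it says
  \<open>2 * axis_gf / (1 - axis_gf) = quartic_root - 1\<close>, which inverts \<^const>\<open>cayley\<close>. Keeping
  the remainder explicit avoids infinite sums of power series: it has no terms up to degree \<open>n\<close>.
\<close>

lemma sum_axis_gf_powers: "2 * (\<Sum>k=1..n. axis_gf ^ k) = (quartic_root - 1) - (quartic_root + 1) * axis_gf ^ Suc n"
proof (induction n)
  case 0
  then show ?case using cayley_iff[OF quartic_root_nth_0] by (simp add: axis_gf_def mult.commute)
next
  case (Suc n)
  have "(quartic_root + 1) * axis_gf ^ Suc n - (quartic_root + 1) * axis_gf ^ Suc (Suc n)
      = axis_gf ^ Suc n * ((quartic_root + 1) - axis_gf * (quartic_root + 1))"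
    by (simp add: algebra_simps)
  also have "axis_gf * (quartic_root + 1) = quartic_root - 1"
    unfolding axis_gf_def by (rule cayley_iff) (rule quartic_root_nth_0)
  finally have diff: "(quartic_root + 1) * axis_gf ^ Suc n - (quartic_root + 1) * axis_gf ^ Suc (Suc n) = 2 * axis_gf ^ Suc n"
    by simp
  have "2 * (\<Sum>k=1..Suc n. axis_gf ^ k) = 2 * (\<Sum>k=1..n. axis_gf ^ k) + 2 * axis_gf ^ Suc n"
    by (simp add: distrib_left)
  then show ?case unfolding Suc diff[symmetric] by (simp only: add_diff_eq diff_add_cancel)
qed

abbreviation geometric :: "real fps" where
  "geometric \<equiv> Abs_fps (\<lambda>_. 1)"

lemma geometric_mult: "geometric * (1 - fps_X) = 1"
  using fps_inverse_gp'[where ?'a = real]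
  by (metis fps_inverse_eq_0_iff fps_nth_Abs_fps inverse_mult_eq_1' one_neq_zero)

text \<open>
  To gain \<open>d\<close> columns from height \<open>m\<close> the walk descends \<open>m\<close> vertices and then advances \<open>d\<close>
  times along the axis, and these times are independent. The factor \<^term>\<open>geometric\<close> passes
  from the probability of arriving at time \<open>n\<close> to that of arriving up to time \<open>n\<close>.
\<close>

definition hit_fps :: "nat \<Rightarrow> nat \<Rightarrow> real fps" where
  "hit_fps d m = axis_gf ^ d * tooth_gf ^ m * geometric"

lemma hit_fps_0_0: "hit_fps 0 0 $ n = 1"
  by (simp add: hit_fps_def)

lemma hit_fps_nth_0: "d > 0 \<Longrightarrow> hit_fps d m $ 0 = 0"
  by (simp add: hit_fps_def axis_gf_nth_0)

text \<open>
  The next two lemmas are the recursions of \<^const>\<open>hit_prob\<close> off the axis and on it.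
\<close>

lemma hit_fps_tooth:
  "hit_fps d (Suc m) $ Suc n = (hit_fps d (Suc (Suc m)) $ n + hit_fps d m $ n) / 2"
proof -
  have "2 * hit_fps d (Suc m) = axis_gf ^ d * tooth_gf ^ m * geometric * (2 * tooth_gf)"
    by (simp add: hit_fps_def mult_ac)
  also have "\<dots> = fps_X * (hit_fps d (Suc (Suc m)) + hit_fps d m)"
    unfolding tooth_gf_step by (simp add: hit_fps_def algebra_simps power2_eq_square)
  finally have "(2 * hit_fps d (Suc m)) $ Suc n = (fps_X * (hit_fps d (Suc (Suc m)) + hit_fps d m)) $ Suc n"
    by simp
  then show ?thesis by (simp add: numeral_fps_const)
qed

lemma hit_fps_axis:
  "hit_fps (Suc d) 0 $ Suc n
     = (hit_fps (Suc (Suc d)) 0 $ n + hit_fps d 0 $ n + 2 * hit_fps (Suc d) 1 $ n) / 4"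
proof -
  have "4 * hit_fps (Suc d) 0 = axis_gf ^ d * geometric * (4 * axis_gf)"
    by (simp add: hit_fps_def mult_ac)
  also have "\<dots> = fps_X * (hit_fps (Suc (Suc d)) 0 + hit_fps d 0 + 2 * hit_fps (Suc d) 1)"
    unfolding axis_gf_step by (simp add: hit_fps_def algebra_simps power2_eq_square)
  finally have "(4 * hit_fps (Suc d) 0) $ Suc n
      = (fps_X * (hit_fps (Suc (Suc d)) 0 + hit_fps d 0 + 2 * hit_fps (Suc d) 1)) $ Suc n"
    by simp
  then show ?thesis by (simp add: numeral_fps_const)
qed

lemma fps_mult_power_nth_eq_0:
  fixes f g :: "real fps"
  assumes "f $ 0 = 0" and "n < k"
  shows "(g * f ^ k) $ n = 0"
  using assms by (auto simp: fps_mult_nth startsby_zero_power_prefix intro!: sum.neutral)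

lemma hit_fps_far: "n < d \<Longrightarrow> hit_fps d 0 $ n = 0"
  using fps_mult_power_nth_eq_0[OF axis_gf_nth_0, of n d geometric] by (simp add: hit_fps_def mult.commute)

text \<open>
  Up to the correction \<open>-1\<close>, twice the sum is the coefficient of
  \<open>quartic_root / (1 - X) = (1 + X) powr (1/4) * (1 - X) powr (-5/4)\<close>.
\<close>

lemma sum_hit_fps:
  "2 * (\<Sum>k=1..n. hit_fps k 0 $ n)
     = (\<Sum>k\<le>n. ((1/4) gchoose k) * ((-1) ^ (n - k) * ((- (5/4)) gchoose (n - k)))) - 1"
proof -
  have "2 * (\<Sum>k=1..n. hit_fps k 0) = geometric * (2 * (\<Sum>k=1..n. axis_gf ^ k))"
    by (simp add: hit_fps_def sum_distrib_left mult_ac)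
  also have "\<dots> = quartic_root * geometric - geometric - geometric * (quartic_root + 1) * axis_gf ^ Suc n"
    unfolding sum_axis_gf_powers by (simp add: algebra_simps)
  finally have "(2 * (\<Sum>k=1..n. hit_fps k 0)) $ n = (quartic_root * geometric) $ n - 1"
    using fps_mult_power_nth_eq_0[OF axis_gf_nth_0, of n "Suc n"] by (simp del: power_Suc)
  then have "2 * (\<Sum>k=1..n. hit_fps k 0 $ n) = (quartic_root * geometric) $ n - 1"
    by (simp add: numeral_fps_const fps_sum_nth)
  moreover have "quartic_root * geometric = fps_binomial (1/4) * (fps_binomial (- (5/4)) oo - fps_X)"
  proof -
    have "fps_binomial (- (1/4)) oo - fps_X = (fps_binomial (- (5/4)) oo - fps_X) * (1 - fps_X :: real fps)"
      using binomial_uminus_add[of "- (5/4)" 1] unfolding binomial_uminus_1 by simp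
    then have "quartic_root * geometric
        = fps_binomial (1/4) * (fps_binomial (- (5/4)) oo - fps_X) * (geometric * (1 - fps_X))"
      by (simp add: quartic_root_def mult_ac)
    then show ?thesis unfolding geometric_mult by simp
  qed
  ultimately show ?thesis
    by (simp add: fps_mult_nth fps_compose_uminus' atMost_atLeast0)
qed

lemma comb_neighbours_finite: "finite {v. comb_adj u v}"
  using comb_neighbours_axis[of "fst u"] comb_neighbours_off_axis[of "snd u" "fst u"]
  by (cases u; cases "snd u = 0") auto

lemma comb_neighbours_nonempty: "{v. comb_adj u v} \<noteq> {}"
  using comb_neighbours_axis[of "fst u"] comb_neighbours_off_axis[of "snd u" "fst u"]
  by (cases u; cases "snd u = 0") auto

text \<open>
  Both sides satisfy the same recursion in \<open>n\<close>, so the guess for the generating function need only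
  be checked against it. A starting point in the column \<open>k\<close> itself but off the axis is excluded:
  there the hitting probability is \<open>1\<close>, while \<^const>\<open>hit_fps\<close> would describe the return to the
  axis. Such points are never reached before the column is hit, because columns are entered
  on the axis.
\<close>

lemma hit_prob_halfplane:
  assumes "d > 0 \<or> y = 0"
  shows "hit_prob comb_adj {v. k \<le> fst v} n (k - int d, y) = hit_fps d (nat \<bar>y\<bar>) $ n"
  using assms
proof (induction n arbitrary: d y)
  case 0
  then show ?case by (cases "d = 0") (auto simp: hit_fps_0_0 hit_fps_nth_0)
next
  case (Suc n)
  show ?case
  proof (cases d)
    case 0
    then show ?thesis using Suc.prems by (simp add: hit_fps_0_0)
  next
    case d: (Suc e)
    let ?h = "hit_prob comb_adj {v. k \<le> fst v} n"
    show ?thesis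
    proof (cases "y = 0")
      case True
      have nbr: "{u. comb_adj (k - int d, 0) u}
          = {(k - int d, 1), (k - int d, - 1), (k - int e, 0), (k - int (Suc d), 0)}"
        unfolding comb_neighbours_axis d by (simp add: algebra_simps)
      have "hit_prob comb_adj {v. k \<le> fst v} (Suc n) (k - int d, 0)
          = (?h (k - int d, 1) + ?h (k - int d, - 1) + ?h (k - int e, 0) + ?h (k - int (Suc d), 0)) / 4"
        unfolding hit_prob.simps nbr by (simp add: d)
      also have "\<dots> = hit_fps (Suc e) 0 $ Suc n"
        using Suc.IH[of d 1] Suc.IH[of d "-1"] Suc.IH[of e 0] Suc.IH[of "Suc d" 0]
        unfolding hit_fps_axis by (simp add: d)
      finally show ?thesis using True d by simp
    next
      case False
      obtain m where m: "nat \<bar>y\<bar> = Suc m" using False by (cases "nat \<bar>y\<bar>") auto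
      have "hit_prob comb_adj {v. k \<le> fst v} (Suc n) (k - int d, y)
          = (?h (k - int d, y + 1) + ?h (k - int d, y - 1)) / 2"
        unfolding hit_prob.simps comb_neighbours_off_axis[OF False] by (simp add: d)
      also have "\<dots> = (hit_fps d (nat \<bar>y + 1\<bar>) $ n + hit_fps d (nat \<bar>y - 1\<bar>) $ n) / 2"
        using Suc.IH[of d "y + 1"] Suc.IH[of d "y - 1"] d by simp
      also have "\<dots> = (hit_fps d (Suc (Suc m)) $ n + hit_fps d m $ n) / 2"
      proof (cases "y > 0")
        case True
        then have "nat \<bar>y + 1\<bar> = Suc (Suc m)" "nat \<bar>y - 1\<bar> = m" using m by auto
        then show ?thesis by (simp only:)
      next
        case neg: False
        then have "nat \<bar>y + 1\<bar> = m" "nat \<bar>y - 1\<bar> = Suc (Suc m)" using m \<open>y \<noteq> 0\<close> by auto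
        then show ?thesis by (simp only: add.commute)
      qed
      finally show ?thesis unfolding m hit_fps_tooth .
    qed
  qed
qed

section \<open>The expected range\<close>

definition x_max :: "(nat \<Rightarrow> 'w \<Rightarrow> int \<times> int) \<Rightarrow> nat \<Rightarrow> 'w \<Rightarrow> int" where
  "x_max S n \<omega> = Max ((\<lambda>i. fst (S i \<omega>)) ` {..n})"

definition mirror :: "int \<times> int \<Rightarrow> int \<times> int" where
  "mirror v = (- fst v, snd v)"

text \<open>
  The minimum of the first coordinate is the negated maximum of the mirrored walk, so by symmetry
  only the maximum has to be studied.
\<close>

lemma x_range_eq_x_max: "x_range S n \<omega> = x_max S n \<omega> + x_max (\<lambda>i \<omega>. mirror (S i \<omega>)) n \<omega>"
proof -
  let ?D = "{fst (S i \<omega>) - fst (S j \<omega>) | i j. i \<le> n \<and> j \<le> n}"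
  let ?A = "(\<lambda>i. fst (S i \<omega>)) ` {..n}" and ?B = "(\<lambda>i. - fst (S i \<omega>)) ` {..n}"
  have D: "?D = (\<lambda>(i, j). fst (S i \<omega>) - fst (S j \<omega>)) ` ({..n} \<times> {..n})" by auto
  have "Max ?D = Max ?A + Max ?B"
  proof (rule Max_eqI)
    show "finite ?D" unfolding D by simp
    have "Max ?A \<in> ?A" "Max ?B \<in> ?B" by (intro Max_in; simp)+
    then obtain i j where "i \<le> n" "Max ?A = fst (S i \<omega>)" "j \<le> n" "Max ?B = - fst (S j \<omega>)"
      by (elim imageE) simp
    then have "Max ?A + Max ?B = fst (S i \<omega>) - fst (S j \<omega>)" by simp
    with \<open>i \<le> n\<close> \<open>j \<le> n\<close> show "Max ?A + Max ?B \<in> ?D" by blast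
    fix x assume "x \<in> ?D"
    then obtain i j where "i \<le> n" "j \<le> n" "x = fst (S i \<omega>) + - fst (S j \<omega>)" by auto
    moreover have "fst (S i \<omega>) \<le> Max ?A" "- fst (S j \<omega>) \<le> Max ?B"
      using \<open>i \<le> n\<close> \<open>j \<le> n\<close> by (intro Max_ge; simp)+
    ultimately show "x \<le> Max ?A + Max ?B" by linarith
  qed
  then show ?thesis by (simp add: x_range_def x_max_def mirror_def)
qed

lemma le_x_max_iff: "k \<le> x_max S n \<omega> \<longleftrightarrow> (\<exists>i\<le>n. S i \<omega> \<in> {v. k \<le> fst v})"
  unfolding x_max_def by (subst Max_ge_iff) auto

lemma real_eq_sum_of_bool:
  assumes "0 \<le> m" "m \<le> int n"
  shows "real_of_int m = (\<Sum>k=1..n. of_bool (int k \<le> m))"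
proof -
  have "(\<Sum>k=1..n. of_bool (int k \<le> m)) = real (card ({1..n} \<inter> {k. int k \<le> m}))"
    by (simp add: sum_of_bool_eq)
  also have "{1..n} \<inter> {k. int k \<le> m} = {1..nat m}" using assms by auto
  finally show ?thesis using assms by simp
qed

text \<open>
  The tail-sum formula: the maximum is at least \<open>k\<close> iff the half-plane of the columns from \<open>k\<close>
  on has been hit. The sum stops at \<open>n\<close> because the column \<open>n + 1\<close> cannot be reached in \<open>n\<close> steps.
\<close>

lemma expectation_x_max:
  assumes "simple_random_walk M comb_adj (0, 0) S"
  shows "has_bochner_integral M (\<lambda>\<omega>. real_of_int (x_max S n \<omega>)) (\<Sum>k=1..n. hit_fps k 0 $ n)"
proof -
  interpret simple_random_walk M comb_adj "(0, 0)" S by fact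
  note [measurable] = walk_in_measurable
  have tail: "\<P>(\<omega> in M. int k \<le> x_max S n \<omega>) = hit_fps k 0 $ n" for k
    unfolding le_x_max_iff
    using prob_hit[OF comb_neighbours_finite comb_neighbours_nonempty, of n "{v. int k \<le> fst v}"]
      hit_prob_halfplane[of k 0 "int k" n] by simp
  have meas [measurable]: "Measurable.pred M (\<lambda>\<omega>. k \<le> x_max S n \<omega>)" for k
    unfolding le_x_max_iff by measurable
  have "prob {\<omega> \<in> space M. int (Suc n) \<le> x_max S n \<omega>} = 0"
    unfolding tail by (rule hit_fps_far) simp
  moreover have "{\<omega> \<in> space M. int (Suc n) \<le> x_max S n \<omega>} \<in> events" by measurable
  ultimately have "AE \<omega> in M. \<omega> \<notin> {\<omega> \<in> space M. int (Suc n) \<le> x_max S n \<omega>}"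
    using prob_eq_0 by blast
  with start AE_space have eq: "AE \<omega> in M. real_of_int (x_max S n \<omega>) = (\<Sum>k=1..n. indicator {\<omega> \<in> space M. int k \<le> x_max S n \<omega>} \<omega>)"
  proof eventually_elim
    case (elim \<omega>)
    have "0 \<le> x_max S n \<omega>" unfolding le_x_max_iff using elim by (intro exI[of _ 0]) simp
    moreover have "x_max S n \<omega> \<le> int n" using elim by simp
    ultimately have "real_of_int (x_max S n \<omega>) = (\<Sum>k=1..n. of_bool (int k \<le> x_max S n \<omega>))"
      by (rule real_eq_sum_of_bool)
    then show ?case using elim by (simp add: indicator_def)
  qed
  have sum: "has_bochner_integral M (\<lambda>\<omega>. \<Sum>k=1..n. indicator {\<omega> \<in> space M. int k \<le> x_max S n \<omega>} \<omega>)
      (\<Sum>k=1..n. hit_fps k 0 $ n)"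
    unfolding tail[symmetric]
    by (intro has_bochner_integral_sum has_bochner_integral_real_indicator)
       (auto simp: emeasure_eq_measure)
  show ?thesis
  proof (rule has_bochner_integralI_AE[OF sum])
    have "a \<le> real_of_int (x_max S n \<omega>) \<longleftrightarrow> \<lceil>a\<rceil> \<le> x_max S n \<omega>" for a \<omega>
      by (simp add: ceiling_le_iff)
    then show "(\<lambda>\<omega>. real_of_int (x_max S n \<omega>)) \<in> borel_measurable M"
      unfolding borel_measurable_iff_ge by simp
    show "AE \<omega> in M. (\<Sum>k=1..n. indicator {\<omega> \<in> space M. int k \<le> x_max S n \<omega>} \<omega>) = real_of_int (x_max S n \<omega>)"
      using eq by eventually_elim (rule sym)
  qed
qed

lemma expectation_x_range:
  assumes "simple_random_walk M comb_adj (0, 0) S"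
  shows "prob_space.expectation M (\<lambda>\<omega>. real_of_int (x_range S n \<omega>)) = 2 * (\<Sum>k=1..n. hit_fps k 0 $ n)"
proof -
  have "simple_random_walk M comb_adj (mirror (0, 0)) (\<lambda>i \<omega>. mirror (S i \<omega>))"
  proof (rule simple_random_walk_automorphism[OF assms])
    show "bij mirror" by (rule o_bij[of mirror]) (auto simp: mirror_def)
    show "comb_adj (mirror u) (mirror w) \<longleftrightarrow> comb_adj u w" for u w
      by (auto simp: comb_adj_def mirror_def)
  qed (rule comb_neighbours_finite comb_neighbours_nonempty)+
  then have "simple_random_walk M comb_adj (0, 0) (\<lambda>i \<omega>. mirror (S i \<omega>))"
    by (simp add: mirror_def)
  from has_bochner_integral_add[OF expectation_x_max[OF assms] expectation_x_max[OF this], of n n]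
  show ?thesis
    unfolding x_range_eq_x_max by (simp add: has_bochner_integral_integral_eq)
qed

section \<open>Coefficient asymptotics\<close>

text \<open>
  Since \<open>b\<close> varies slowly, \<open>b (n - k) / b n\<close> tends to \<open>1\<close> for every fixed \<open>k\<close>, and it is at
  most \<open>1\<close> by monotonicity; so Tannery's theorem applies with the majorant \<open>\<bar>c k\<bar>\<close>.
\<close>

lemma convolution_ratio_tendsto:
  fixes b c :: "nat \<Rightarrow> real"
  assumes c: "summable (\<lambda>k. \<bar>c k\<bar>)"
    and pos: "\<And>n. 0 < b n" and mono: "\<And>n. b n \<le> b (Suc n)"
    and ratio: "(\<lambda>n. b n / b (Suc n)) \<longlonglongrightarrow> 1"
  shows "(\<lambda>n. (\<Sum>k\<le>n. c k * b (n - k)) / b n) \<longlonglongrightarrow> suminf c"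
proof -
  let ?a = "\<lambda>k n. if k \<le> n then c k * (b (n - k) / b n) else 0"
  have mono': "b m \<le> b n" if "m \<le> n" for m n
    using mono that by (rule lift_Suc_mono_le)
  have shift: "(\<lambda>n. b n / b (n + k)) \<longlonglongrightarrow> 1" for k
  proof (induction k)
    case 0
    have "b n \<noteq> 0" for n using pos[of n] by simp
    then show ?case by simp
  next
    case (Suc k)
    have "(\<lambda>n. (b n / b (n + k)) * (b (n + k) / b (Suc (n + k)))) \<longlonglongrightarrow> 1 * 1"
      using Suc ratio LIMSEQ_ignore_initial_segment[OF ratio, of k] by (intro tendsto_mult) auto
    moreover have "(b n / b (n + k)) * (b (n + k) / b (Suc (n + k))) = b n / b (n + Suc k)" for n
      using less_imp_neq[OF pos[of "n + k"]] by simp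
    ultimately show ?case by (simp only: mult_1)
  qed
  have lim: "?a k \<longlonglongrightarrow> c k" for k
  proof (rule LIMSEQ_offset[where k = k])
    show "(\<lambda>n. ?a k (n + k)) \<longlonglongrightarrow> c k"
      using tendsto_mult_left[OF shift[of k], of "c k"] by simp
  qed
  have bound: "norm (?a k n) \<le> \<bar>c k\<bar>" for k n
    using pos[of "n - k"] pos[of n] mono'[of "n - k" n]
      mult_left_le[of "b (n - k) / b n" "\<bar>c k\<bar>"]
    by (auto simp: abs_mult)
  have "(\<lambda>n. \<Sum>k. ?a k n) \<longlonglongrightarrow> suminf c"
    using tannerys_theorem[of ?a c sequentially "\<lambda>k. \<bar>c k\<bar>"] lim bound c
    by (simp add: case_prod_unfold)
  moreover have "(\<Sum>k. ?a k n) = (\<Sum>k\<le>n. c k * b (n - k)) / b n" for n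
    by (subst suminf_finite[of "{..n}"]) (auto simp: sum_divide_distrib)
  ultimately show ?thesis by simp
qed

lemma gbinomial_asymptotic_powr:
  "(\<lambda>n. (-1) ^ n * (a gchoose n) / real n powr (- a - 1)) \<longlonglongrightarrow> inverse (Gamma (- a :: real))"
proof (rule Lim_transform_eventually[OF gbinomial_asymptotic[of a]])
  show "\<forall>\<^sub>F n in sequentially. (a gchoose n) / ((- 1) ^ n / exp ((a + 1) * of_real (ln (real n))))
      = (-1) ^ n * (a gchoose n) / real n powr (- a - 1)"
    using eventually_gt_at_top[of 0]
  proof eventually_elim
    case (elim n)
    have "exp ((a + 1) * ln (real n)) = inverse (real n powr (- a - 1))"
      using elim by (simp add: powr_def exp_minus[symmetric] algebra_simps)
    then show ?case by (cases "even n") (simp_all add: field_simps)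
  qed
qed

lemma summable_abs_gbinomial:
  assumes "(a::real) > 0"
  shows "summable (\<lambda>k. \<bar>a gchoose k\<bar>)"
proof (rule summable_comparison_test_bigo)
  have "- a - 1 < - 1" using assms by simp
  then show "summable (\<lambda>k. norm (real k powr (- a - 1)))"
    by (simp add: summable_real_powr_iff)
  have "(\<lambda>k. (-1) ^ k * (a gchoose k)) \<in> O(\<lambda>k. real k powr (- a - 1))"
    by (rule bigoI_tendsto[OF gbinomial_asymptotic_powr])
       (use eventually_gt_at_top[of 0] in eventually_elim, simp)
  then have "(\<lambda>k. \<bar>(-1) ^ k * (a gchoose k)\<bar>) \<in> O(\<lambda>k. real k powr (- a - 1))"
    by simp
  then show "(\<lambda>k. \<bar>a gchoose k\<bar>) \<in> O(\<lambda>k. real k powr (- a - 1))"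
    by (simp add: abs_mult power_abs)
qed

text \<open>
  The binomial series at the boundary point \<open>1\<close> of its disc of convergence, as a left limit.
\<close>

lemma suminf_gbinomial:
  assumes "(a::real) > 0"
  shows "(\<Sum>k. a gchoose k) = 2 powr a"
proof (rule tendsto_unique)
  let ?a = "\<lambda>k z. (a gchoose k) * z ^ k"
  have near: "\<forall>\<^sub>F z::real in at_left 1. z \<in> {0<..<1}"
    by (rule eventually_at_left_real) simp
  show "((\<lambda>z. \<Sum>k. ?a k z) \<longlongrightarrow> (\<Sum>k. a gchoose k)) (at_left 1)"
  proof -
    have "\<forall>\<^sub>F z in at_left 1. \<forall>k. norm (?a k z) \<le> \<bar>a gchoose k\<bar>"
      using near by eventually_elim (auto simp: abs_mult power_abs intro!: mult_left_le power_le_one)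
    then have "\<forall>\<^sub>F (k, z) in at_top \<times>\<^sub>F at_left 1. norm (?a k z) \<le> \<bar>a gchoose k\<bar>"
      unfolding eventually_prod_filter
      by (intro exI[of _ "\<lambda>_. True"] exI[of _ "\<lambda>z. \<forall>k. norm (?a k z) \<le> \<bar>a gchoose k\<bar>"]) auto
    moreover have "(?a k \<longlongrightarrow> (a gchoose k)) (at_left 1)" for k
    proof -
      have "(?a k \<longlongrightarrow> (a gchoose k) * 1 ^ k) (at_left 1)" by (intro tendsto_intros)
      then show ?thesis by simp
    qed
    ultimately show ?thesis
      using tannerys_theorem[of ?a "\<lambda>k. a gchoose k" "at_left 1" "\<lambda>k. \<bar>a gchoose k\<bar>"]
        summable_abs_gbinomial[OF assms] by auto
  qed
  have "((\<lambda>z::real. (1 + z) powr a) \<longlongrightarrow> (1 + 1) powr a) (at_left 1)"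
    by (intro tendsto_intros) auto
  moreover have "\<forall>\<^sub>F z in at_left 1. (1 + z) powr a = (\<Sum>k. ?a k z)"
    using near by eventually_elim (simp add: sums_unique[OF gen_binomial_real])
  ultimately show "((\<lambda>z. \<Sum>k. ?a k z) \<longlongrightarrow> 2 powr a) (at_left 1)"
    by (auto intro: Lim_transform_eventually)
qed simp

lemma signed_gbinomial_Suc:
  "real (Suc n) * ((-1) ^ Suc n * (a gchoose Suc n)) = (real n - a) * ((-1) ^ n * (a gchoose n))"
  using gbinomial_mult_1[of a n] by (cases "even n") (simp_all add: algebra_simps)

text \<open>
  The sum is the coefficient of \<open>(1 + X) powr a * (1 - X) powr b\<close>. The second factor has the
  dominant singularity, at \<open>1\<close>, and its coefficients are asymptotic to
  \<open>n powr (- b - 1) / Gamma (- b)\<close>; the first factor contributes its value \<open>2 powr a\<close> there.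
\<close>

lemma binomial_convolution_tendsto:
  fixes a b :: real
  assumes "a > 0" and "b < -1"
  shows "(\<lambda>n. (\<Sum>k\<le>n. (a gchoose k) * ((-1) ^ (n - k) * (b gchoose (n - k)))) / real n powr (- b - 1))
           \<longlonglongrightarrow> 2 powr a / Gamma (- b)"
proof -
  let ?b = "\<lambda>n. (-1) ^ n * (b gchoose n)"
  have rec: "?b (Suc n) = (real n - b) / (real n + 1) * ?b n" for n
    using signed_gbinomial_Suc[of n b] by (simp add: field_simps)
  have pos: "0 < ?b n" for n
  proof (induction n)
    case (Suc n)
    show ?case unfolding rec
      by (intro mult_pos_pos divide_pos_pos Suc.IH) (use assms in auto)
  qed simp
  have mono: "?b n \<le> ?b (Suc n)" for n
  proof -
    have "1 \<le> (real n - b) / (real n + 1)" using assms by simp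
    from mult_right_mono[OF this, of "?b n"] pos[of n] show ?thesis unfolding rec by simp
  qed
  have ratio: "(\<lambda>n. ?b n / ?b (Suc n)) \<longlonglongrightarrow> 1"
  proof -
    have "?b n / ?b (Suc n) = (real n + 1) / (real n - b)" for n
      unfolding rec using less_imp_neq[OF pos[of n]] assms by simp
    moreover have "(\<lambda>n. (real n + 1) / (real n - b)) \<longlonglongrightarrow> 1" by real_asymp
    ultimately show ?thesis by simp
  qed
  have "(\<lambda>n. (\<Sum>k\<le>n. (a gchoose k) * ?b (n - k)) / ?b n * (?b n / real n powr (- b - 1)))
      \<longlonglongrightarrow> 2 powr a * inverse (Gamma (- b))"
    unfolding suminf_gbinomial[OF assms(1), symmetric]
    by (intro tendsto_mult convolution_ratio_tendsto summable_abs_gbinomial assms pos mono ratio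
          gbinomial_asymptotic_powr)
  moreover have "x / ?b n * (?b n / y) = x / y" for n x y
    using less_imp_neq[OF pos[of n]] by simp
  ultimately show ?thesis by (simp only: divide_inverse)
qed

theorem theorem5p1:
  fixes M :: "'w measure" and S :: "nat \<Rightarrow> 'w \<Rightarrow> int \<times> int"
  assumes "simple_random_walk M comb_adj (0, 0) S"
  shows "(\<lambda>n::nat. prob_space.expectation M (\<lambda>\<omega>. real_of_int (x_range S n \<omega>)))
           \<sim>[at_top] (\<lambda>n. 2 powr (1 / 4) / Gamma (5 / 4) * real n powr (1 / 4))"
proof (rule asymp_equivI'_const)
  let ?s = "\<lambda>n. \<Sum>k\<le>n. ((1/4) gchoose k) * ((-1) ^ (n - k) * ((- (5/4)) gchoose (n - k)))"
  have "(\<lambda>n. ?s n / real n powr (1/4)) \<longlonglongrightarrow> 2 powr (1/4) / Gamma (5/4)"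
    using binomial_convolution_tendsto[of "1/4" "- (5/4)"] by simp
  moreover have "(\<lambda>n. 1 / real n powr (1/4)) \<longlonglongrightarrow> 0" by real_asymp
  ultimately have "(\<lambda>n. ?s n / real n powr (1/4) - 1 / real n powr (1/4))
      \<longlonglongrightarrow> 2 powr (1/4) / Gamma (5/4) - 0"
    by (rule tendsto_diff)
  then show "(\<lambda>n. prob_space.expectation M (\<lambda>\<omega>. real_of_int (x_range S n \<omega>)) / real n powr (1/4))
      \<longlonglongrightarrow> 2 powr (1/4) / Gamma (5/4)"
    unfolding expectation_x_range[OF assms] sum_hit_fps by (simp add: diff_divide_distrib)
  have "Gamma (5/4 :: real) > 0" by (rule Gamma_real_pos) simp
  from less_imp_neq[OF this] show "2 powr (1/4) / Gamma (5/4 :: real) \<noteq> 0" by simp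
qed

end
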